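(* Define polynomials $\Lambda_k=\Lambda_k(\lambda)$, $k\ge 1$, by $\Lambda_1=\lambda$, $\Lambda_2=\lambda^2-128$, and $\Lambda_k=\lambda\Lambda_{k-1}-128\Lambda_{k-2}$ for every $k\ge 3$. Then for every $n\ge 5$ the elliptic Sombor characteristic polynomial of the path graph $P_n$ on $n$ vertices satisfies $$\phi_{ESO}(P_n,\lambda)=\lambda^2\Lambda_{n-2}-90\lambda\Lambda_{n-3}+2025\Lambda_{n-4}.$$ Moreover, $\phi_{ESO}(P_2,\lambda)=\lambda^2-8$, $\phi_{ESO}(P_3,\lambda)=\lambda^3-90\lambda$, and $\phi_{ESO}(P_4,\lambda)=\lambda^4-218\lambda^2+2025$.
   Context: For a simple graph $G$ with vertex set $\{v_1,\ldots,v_n\}$, let $d_i$ denote the degree of $v_i$. The elliptic Sombor matrix $A_{ESO}(G)$ is the $n\times n$ real symmetric matrix whose $(i,j)$-entry is $(d_i+d_j)\sqrt{d_i^2+d_j^2}$ if $v_i$ and $v_j$ are adjacent, and $0$ otherwise. The elliptic Sombor characteristic polynomial is $\phi_{ESO}(G,\lambda)=\det(\lambda I-A_{ESO}(G))$. *)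

theory Defs
  imports "Graph_Theory.Pair_Digraph" "Jordan_Normal_Form.Char_Poly" Complex_Main
begin

text \<open>
  A finite simple graph is modelled as in the theory Digraph: a finite symmetric digraph without
  loops and multiple arcs (locale \<^locale>\<open>graph\<close>), each edge being a pair of opposite arcs. So
  adjacency is \<^term>\<open>u \<rightarrow>\<^bsub>G\<^esub> v\<close>, and the number of neighbours of a vertex is its out-degree.
\<close>

definition eso_weight :: "('a, 'b) pre_digraph \<Rightarrow> 'a \<Rightarrow> 'a \<Rightarrow> real" where
  "eso_weight G u v =
     (if u \<rightarrow>\<^bsub>G\<^esub> v
      then (real (out_degree G u) + real (out_degree G v)) *
           sqrt (real (out_degree G u) ^ 2 + real (out_degree G v) ^ 2)
      else 0)"

text \<open>
  Rows and columns are indexed by the vertices in increasing order; another enumeration would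
  conjugate the matrix by a permutation matrix and leave its characteristic polynomial unchanged.
\<close>

definition eso_matrix :: "('a :: linorder, 'b) pre_digraph \<Rightarrow> real mat" where
  "eso_matrix G =
     (let vs = sorted_list_of_set (verts G)
      in mat (card (verts G)) (card (verts G)) (\<lambda>(i, j). eso_weight G (vs ! i) (vs ! j)))"

definition eso_char_poly :: "('a :: linorder, 'b) pre_digraph \<Rightarrow> real poly" where
  "eso_char_poly G = char_poly (eso_matrix G)"

definition path_graph :: "nat \<Rightarrow> nat pair_pre_digraph" where
  "path_graph n =
     \<lparr>pverts = {1..n},
      parcs = {(i, j). i \<in> {1..n} \<and> j \<in> {1..n} \<and> (j = i + 1 \<or> i = j + 1)}\<rparr>"

lemma pair_graph_path_graph: "pair_graph (path_graph n)"
proof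
  have "parcs (path_graph n) \<subseteq> {1..n} \<times> {1..n}"
    by (auto simp: path_graph_def)
  then show "finite (parcs (path_graph n))"
    by (rule finite_subset) simp
  show "symmetric (with_proj (path_graph n))"
    by (auto simp: symmetric_def path_graph_def intro!: symI)
qed (auto simp: path_graph_def)

abbreviation lam :: "real poly" where
  "lam \<equiv> [:0, 1:]"

text \<open>The sequence starts at index 1; its value at 0 is left unspecified.\<close>

fun Lam :: "nat \<Rightarrow> real poly" where
  "Lam (Suc 0) = lam"
| "Lam (Suc (Suc 0)) = lam ^ 2 - 128"
| "Lam (Suc (Suc (Suc k))) = lam * Lam (Suc (Suc k)) - 128 * Lam (Suc k)"

end

theory Submission
  imports Defs
begin

text \<open>
  With the vertices of \<open>P\<^sub>n\<close> in their natural order, the matrix \<open>\<lambda>I - A\<close> is tridiagonal, and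
  Laplace expansion along its last row shows that its leading principal minors satisfy a
  three-term recurrence in which every edge enters only through the square of its weight
  (\<open>det_tridiagonal\<close>). A pendant edge has squared weight \<open>(1+2)\<^sup>2(1+4) = 45\<close> and an
  inner edge has \<open>(2+2)\<^sup>2(4+4) = 128\<close>. So all but the first and the last step of the recurrence
  are the recurrence defining \<^const>\<open>Lam\<close>: the pendant edge at one end makes the minor of order
  \<open>k\<close>, for \<open>3 \<le> k < n\<close>, equal to \<open>\<lambda>\<Lambda>\<^bsub>k-1\<^esub> - 45\<Lambda>\<^bsub>k-2\<^esub>\<close> (\<open>continuant_one_pendant_edge\<close>), and the
  pendant edge at the other end combines the minors of order \<open>n - 1\<close> and \<open>n - 2\<close> once more in
  this way. The constants \<open>90 = 2 \<sqdot> 45\<close> and \<open>2025 = 45\<^sup>2\<close> come from applying the step twice.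
  The single edge of \<open>P\<^sub>2\<close> is pendant at both ends and has squared weight
  \<open>(1+1)\<^sup>2(1+1) = 8\<close>.
\<close>

text \<open>
  Euler's continuant in its signed form: \<open>c i\<close> is the product of the two off-diagonal entries
  linking the indices \<open>i\<close> and \<open>i + 1\<close>.
\<close>

fun continuant :: "(nat \<Rightarrow> 'a :: comm_ring_1) \<Rightarrow> (nat \<Rightarrow> 'a) \<Rightarrow> nat \<Rightarrow> 'a" where
  "continuant a c 0 = 1"
| "continuant a c (Suc 0) = a 0"
| "continuant a c (Suc (Suc n)) =
     a (Suc n) * continuant a c (Suc n) - c n * continuant a c n"

lemma continuant_cong:
  assumes "\<And>i. i + 1 < n \<Longrightarrow> c i = d i"
  shows "continuant a c n = continuant a d n"
  using assms by (induction a c n rule: continuant.induct) auto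

definition tridiagonal ::
    "(nat \<Rightarrow> 'a :: zero) \<Rightarrow> (nat \<Rightarrow> 'a) \<Rightarrow> (nat \<Rightarrow> 'a) \<Rightarrow> nat \<Rightarrow> 'a mat" where
  "tridiagonal a u l n = mat n n (\<lambda>(i, j).
     if i = j then a i else if j = i + 1 then u i else if i = j + 1 then l j else 0)"

text \<open>
  At most two entries of the last row are nonzero. Deleting row and column of the diagonal one leaves
  the tridiagonal matrix of the next smaller order; for the other one, the remaining matrix has a
  last column that is zero above the superdiagonal entry in its bottom row, so a second expansion reaches the
  matrix smaller by two.
\<close>

lemma det_tridiagonal_step:
  fixes a u l :: "nat \<Rightarrow> 'a :: comm_ring_1"
  shows "det (tridiagonal a u l (Suc (Suc n))) =
    a (Suc n) * det (tridiagonal a u l (Suc n)) - (u n * l n) * det (tridiagonal a u l n)"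
proof -
  let ?T = "tridiagonal a u l"
  let ?A = "?T (Suc (Suc n))"
  let ?M = "mat_delete ?A (Suc n) n"
  have A: "?A \<in> carrier_mat (Suc (Suc n)) (Suc (Suc n))"
    by (simp add: tridiagonal_def)
  have M: "?M \<in> carrier_mat (Suc n) (Suc n)"
    using A by (auto simp: mat_delete_def)
  have delete_last: "mat_delete ?A (Suc n) (Suc n) = ?T (Suc n)"
    by (rule eq_matI) (auto simp: mat_delete_def tridiagonal_def)
  have delete_M: "mat_delete ?M n n = ?T n"
    by (rule eq_matI) (auto simp: mat_delete_def tridiagonal_def)
  have "det ?M = (\<Sum>i<Suc n. ?M $$ (i, n) * cofactor ?M i n)"
    by (rule laplace_expansion_column[OF M]) simp
  also have "\<dots> = (\<Sum>i<n. ?M $$ (i, n) * cofactor ?M i n) + ?M $$ (n, n) * cofactor ?M n n"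
    by simp
  also have "(\<Sum>i<n. ?M $$ (i, n) * cofactor ?M i n) = 0"
    by (intro sum.neutral) (auto simp: mat_delete_def tridiagonal_def)
  also have "?M $$ (n, n) = u n"
    by (simp add: mat_delete_def tridiagonal_def)
  finally have det_M: "det ?M = u n * det (?T n)"
    by (simp add: cofactor_def delete_M)
  have "det ?A = (\<Sum>j<Suc (Suc n). ?A $$ (Suc n, j) * cofactor ?A (Suc n) j)"
    by (rule laplace_expansion_row[OF A]) simp
  also have "\<dots> = (\<Sum>j<n. ?A $$ (Suc n, j) * cofactor ?A (Suc n) j)
      + ?A $$ (Suc n, n) * cofactor ?A (Suc n) n
      + ?A $$ (Suc n, Suc n) * cofactor ?A (Suc n) (Suc n)"
    by simp
  also have "(\<Sum>j<n. ?A $$ (Suc n, j) * cofactor ?A (Suc n) j) = 0"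
    by (intro sum.neutral) (auto simp: tridiagonal_def)
  also have "?A $$ (Suc n, n) = l n"
    by (simp add: tridiagonal_def)
  also have "?A $$ (Suc n, Suc n) = a (Suc n)"
    by (simp add: tridiagonal_def)
  finally show ?thesis
    by (simp add: cofactor_def delete_last det_M algebra_simps)
qed

lemma det_tridiagonal:
  fixes a u l :: "nat \<Rightarrow> 'a :: comm_ring_1"
  shows "det (tridiagonal a u l n) = continuant a (\<lambda>i. u i * l i) n"
proof (induction n rule: induct_nat_012)
  case 0
  show ?case by (simp add: tridiagonal_def)
next
  case 1
  have "tridiagonal a u l (Suc 0) \<in> carrier_mat 1 1"
    by (simp add: tridiagonal_def)
  then show ?case
    by (simp add: det_single tridiagonal_def)
next
  case (ge2 n)
  then show ?case by (simp add: det_tridiagonal_step)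
qed

lemma out_degree_path_graph:
  assumes "2 \<le> n" "1 \<le> i" "i \<le> n"
  shows "out_degree (with_proj (path_graph n)) i = (if i = 1 \<or> i = n then 1 else 2)"
proof -
  have arcs: "out_arcs (with_proj (path_graph n)) i =
      {e. fst e = i \<and> snd e \<in> {1..n} \<and> (snd e = i + 1 \<or> i = snd e + 1)}"
    using assms by (auto simp: out_arcs_def path_graph_def)
  consider "i = 1" | "i = n" "i \<noteq> 1" | "1 < i" "i < n"
    using assms by linarith
  then show ?thesis
  proof cases
    case 1
    then have "out_arcs (with_proj (path_graph n)) i = {(i, i + 1)}"
      using assms unfolding arcs by auto
    then show ?thesis using 1 by (simp add: out_degree_def)
  next
    case 2
    then have "out_arcs (with_proj (path_graph n)) i = {(i, i - 1)}"
      using assms unfolding arcs by auto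
    then show ?thesis using 2 by (simp add: out_degree_def)
  next
    case 3
    then have "out_arcs (with_proj (path_graph n)) i = {(i, i - 1), (i, i + 1)}"
      unfolding arcs by auto
    then show ?thesis using 3 by (simp add: out_degree_def)
  qed
qed

lemma eso_weight_commute:
  assumes "graph G"
  shows "eso_weight G u v = eso_weight G v u"
proof -
  interpret graph G by (rule assms)
  have "u \<rightarrow>\<^bsub>G\<^esub> v \<longleftrightarrow> v \<rightarrow>\<^bsub>G\<^esub> u"
    using sym_arcs by (auto simp: symmetric_def dest: symD)
  then show ?thesis
    by (simp add: eso_weight_def add.commute)
qed

lemma path_graph_adjacent_iff:
  "i \<rightarrow>\<^bsub>with_proj (path_graph n)\<^esub> j \<longleftrightarrow>
     i \<in> {1..n} \<and> j \<in> {1..n} \<and> (j = i + 1 \<or> i = j + 1)"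
  by (simp add: path_graph_def)

lemma eso_weight_path_graph_square:
  assumes "1 \<le> i" "i < n"
  shows "(eso_weight (with_proj (path_graph n)) i (i + 1))\<^sup>2 =
    (if n = 2 then 8 else if i = 1 \<or> i + 1 = n then 45 else 128)"
proof -
  have "i \<rightarrow>\<^bsub>with_proj (path_graph n)\<^esub> (i + 1)"
    using assms unfolding path_graph_adjacent_iff by auto
  then show ?thesis
    using assms by (auto simp: eso_weight_def out_degree_path_graph power_mult_distrib)
qed

lemma eso_char_poly_path_graph:
  "eso_char_poly (with_proj (path_graph n)) =
     continuant (\<lambda>_. lam)
       (\<lambda>i. if n = 2 then 8 else if i = 0 \<or> i + 2 = n then 45 else 128) n"
  (is "_ = continuant _ ?c n")
proof -
  let ?G = "with_proj (path_graph n)"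
  let ?w = "\<lambda>i. [:- eso_weight ?G (i + 1) (i + 2):]"
  interpret pair_graph "path_graph n"
    by (rule pair_graph_path_graph)
  have "graph ?G" by (rule graph_axioms)
  note commute = eso_weight_commute[OF this]
  have verts: "pverts (path_graph n) = {1..n}"
    by (simp add: path_graph_def)
  have nth: "sorted_list_of_set {Suc 0..n} ! i = Suc i" if "i < n" for i
    using that by (simp add: atLeastAtMost_upt del: upt_Suc)
  have loop: "eso_weight ?G i i = 0" for i
    unfolding eso_weight_def path_graph_adjacent_iff by simp
  have far: "eso_weight ?G i j = 0" if "j \<noteq> i + 1" "i \<noteq> j + 1" for i j
    using that unfolding eso_weight_def path_graph_adjacent_iff by simp
  have "char_poly_matrix (eso_matrix ?G) = tridiagonal (\<lambda>_. lam) ?w ?w n"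
    by (rule eq_matI)
       (auto simp: char_poly_matrix_def eso_matrix_def Let_def verts nth tridiagonal_def
          loop far commute)
  then have "eso_char_poly ?G = continuant (\<lambda>_. lam) (\<lambda>i. ?w i * ?w i) n"
    by (simp add: eso_char_poly_def char_poly_def det_tridiagonal)
  also have "\<dots> = continuant (\<lambda>_. lam) ?c n"
  proof (rule continuant_cong)
    fix i assume i: "i + 1 < n"
    have "?w i * ?w i = [:(eso_weight ?G (i + 1) (i + 1 + 1))\<^sup>2:]"
      by (simp add: power2_eq_square)
    also have "\<dots> = ?c i"
      using i by (subst eso_weight_path_graph_square) (auto simp: numeral_poly)
    finally show "?w i * ?w i = ?c i" .
  qed
  finally show ?thesis .
qed

text \<open>
  This is the expansion along the first row, which separates the exceptional coefficient from a
  continuant with constant coefficients 128. It is proved by induction because both sides satisfy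
  the recurrence of \<^const>\<open>Lam\<close>. The order starts at 3 because \<^const>\<open>Lam\<close> starts at index 1.
\<close>

lemma continuant_one_pendant_edge:
  "continuant (\<lambda>_. lam) (\<lambda>i. if i = 0 then 45 else 128) (k + 3) =
     lam * Lam (k + 2) - 45 * Lam (k + 1)"
proof (induction k rule: induct_nat_012)
  case 0
  show ?case by (simp add: numeral_eq_Suc algebra_simps)
next
  case 1
  show ?case by (simp add: numeral_eq_Suc algebra_simps)
next
  case (ge2 k)
  let ?K = "continuant (\<lambda>_. lam) (\<lambda>i. if i = 0 then 45 else 128)"
  have "?K (Suc (Suc k) + 3) = lam * ?K (Suc k + 3) - 128 * ?K (k + 3)"
    using continuant.simps(3)[of "\<lambda>_. lam" "\<lambda>i. if i = 0 then 45 else 128" "k + 3"] by simp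
  also have "\<dots> = lam * (lam * Lam (Suc k + 2) - 128 * Lam (k + 2))
      - 45 * (lam * Lam (Suc k + 1) - 128 * Lam (k + 1))"
    unfolding ge2 by (simp only: algebra_simps)
  also have "lam * Lam (Suc k + 2) - 128 * Lam (k + 2) = Lam (Suc (Suc k) + 2)"
    by (simp add: eval_nat_numeral)
  also have "lam * Lam (Suc k + 1) - 128 * Lam (k + 1) = Lam (Suc (Suc k) + 1)"
    by simp
  finally show ?case .
qed

theorem theorem2p1:
  "(\<forall>n\<ge>5. eso_char_poly (with_proj (path_graph n)) =
      lam ^ 2 * Lam (n - 2) - 90 * lam * Lam (n - 3) + 2025 * Lam (n - 4)) \<and>
   eso_char_poly (with_proj (path_graph 2)) = lam ^ 2 - 8 \<and>
   eso_char_poly (with_proj (path_graph 3)) = lam ^ 3 - 90 * lam \<and>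
   eso_char_poly (with_proj (path_graph 4)) = lam ^ 4 - 218 * lam ^ 2 + 2025"
proof (intro conjI allI impI)
  fix n :: nat assume "5 \<le> n"
  then obtain k where n: "n = k + 5"
    by (metis le_iff_add add.commute)
  let ?c = "\<lambda>i. if n = 2 then 8 else if i = 0 \<or> i + 2 = n then 45 else (128 :: real poly)"
  let ?d = "\<lambda>i. if i = 0 then 45 else (128 :: real poly)"
  (* A proper leading minor does not involve the last edge, so its only exceptional edge is the first. *)
  have minor: "continuant (\<lambda>_. lam) ?c m = continuant (\<lambda>_. lam) ?d m" if "m < n" for m
    using that n by (intro continuant_cong) auto
  have orders: "n - 2 = k + 3" "n - 3 = k + 2" "n - 4 = k + 1"
    using n by simp_all
  have expand: "x * (x * p - 45 * q) - 45 * (x * q - 45 * r) = x ^ 2 * p - 90 * x * q + 2025 * r"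
    for x p q r :: "real poly"
    by (simp add: algebra_simps power2_eq_square)
  have "continuant (\<lambda>_. lam) ?c n =
      lam * continuant (\<lambda>_. lam) ?c (Suc (k + 3)) - ?c (k + 3) * continuant (\<lambda>_. lam) ?c (k + 3)"
    using continuant.simps(3)[of "\<lambda>_. lam" ?c "k + 3"] by (simp add: n eval_nat_numeral)
  also have "\<dots> = lam * continuant (\<lambda>_. lam) ?d (Suc k + 3)
      - 45 * continuant (\<lambda>_. lam) ?d (k + 3)"
    using minor[of "k + 3"] minor[of "Suc k + 3"] n by simp
  also have "\<dots> = lam * (lam * Lam (k + 3) - 45 * Lam (k + 2))
      - 45 * (lam * Lam (k + 2) - 45 * Lam (k + 1))"
    unfolding continuant_one_pendant_edge by (simp add: numeral_eq_Suc)
  also have "\<dots> = lam ^ 2 * Lam (k + 3) - 90 * lam * Lam (k + 2) + 2025 * Lam (k + 1)"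
    by (rule expand)
  finally show "eso_char_poly (with_proj (path_graph n)) =
      lam ^ 2 * Lam (n - 2) - 90 * lam * Lam (n - 3) + 2025 * Lam (n - 4)"
    by (simp only: eso_char_poly_path_graph orders)
next
  show "eso_char_poly (with_proj (path_graph 2)) = lam ^ 2 - 8"
    unfolding eso_char_poly_path_graph by (simp add: numeral_eq_Suc)
next
  show "eso_char_poly (with_proj (path_graph 3)) = lam ^ 3 - 90 * lam"
    unfolding eso_char_poly_path_graph by (simp add: numeral_eq_Suc)
next
  show "eso_char_poly (with_proj (path_graph 4)) = lam ^ 4 - 218 * lam ^ 2 + 2025"
    unfolding eso_char_poly_path_graph by (simp add: numeral_eq_Suc)
qed

end
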